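(* Let $\mathbb{G}$ be the Gurariĭ space. Every separable Banach space can be isometrically embedded into $\mathbb{G}$; that is, for every separable Banach space $X$ there exists an isometry $f\colon X\to\mathbb{G}$.
   Context: All Banach spaces are over one fixed scalar field (real or complex), the same for all spaces. Isometry: a linear operator $f\colon X\to Y$ between Banach spaces such that $\|f(x)\|=\|x\|$ for every $x\in X$; it is not assumed to be surjective. Gurariĭ space: a separable Banach space $\mathbb{G}$ such that, given finite dimensional Banach spaces $X\subseteq Y$ ($X$ a linear subspace of $Y$ with the inherited norm), given $\varepsilon>0$, and given an isometry (isometric linear embedding) $f\colon X\to\mathbb{G}$, there exists an injective linear operator $g\colon Y\to\mathbb{G}$ extending $f$ and satisfying $\|g\|\cdot\|g^{-1}\|<1+\varepsilon$, where $g^{-1}$ is the inverse of $g$ defined on $g[Y]$ and norms of operators are operator norms. "The Gurariĭ space" means any Banach space with this property (it is unique up to bijective isometry). *)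

theory Defs
  imports "HOL-Analysis.Analysis" "HOL-Library.Function_Algebras"
begin

text \<open>
  The common scalar field is a type \<open>'k\<close> of sort \<open>{real_normed_field, euclidean_space}\<close>, the
  library's idiom for ``real or complex'': both types are instances, and by the theorem of
  Frobenius every instance is isometrically isomorphic to one of them.

  The classes \<open>real_normed_vector\<close> and \<open>banach\<close> only provide scalar multiplication by reals, so
  the multiplication by elements of \<open>'k\<close> is an explicit parameter.
\<close>

locale banach_space_over =
  vector_space scale
  for scale :: "'k::{real_normed_field, euclidean_space} \<Rightarrow> 'a::banach \<Rightarrow> 'a" +
  assumes scale_of_real: "scale (of_real r) x = r *\<^sub>R x"
    and norm_scale: "norm (scale a x) = norm a * norm x"

definition linear_map_on ::
    "('k \<Rightarrow> 'a::plus \<Rightarrow> 'a) \<Rightarrow> ('k \<Rightarrow> 'b::plus \<Rightarrow> 'b) \<Rightarrow> 'a set \<Rightarrow> ('a \<Rightarrow> 'b) \<Rightarrow> bool"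
  where "linear_map_on s1 s2 S f \<longleftrightarrow>
    (\<forall>x\<in>S. \<forall>y\<in>S. f (x + y) = f x + f y) \<and> (\<forall>a. \<forall>x\<in>S. f (s1 a x) = s2 a (f x))"

definition isometry_on ::
    "('k \<Rightarrow> 'a::plus \<Rightarrow> 'a) \<Rightarrow> ('k \<Rightarrow> 'b::plus \<Rightarrow> 'b) \<Rightarrow> 'a set \<Rightarrow> ('a \<Rightarrow> real) \<Rightarrow> ('b \<Rightarrow> real)
      \<Rightarrow> ('a \<Rightarrow> 'b) \<Rightarrow> bool"
  where "isometry_on s1 s2 S N M f \<longleftrightarrow> linear_map_on s1 s2 S f \<and> (\<forall>x\<in>S. M (f x) = N x)"

text \<open>
  The operator norm of \<open>f\<close> on the space \<open>S\<close> with norm \<open>N\<close>, the target having norm \<open>M\<close>. It is taken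
  in the extended reals, so that an unbounded operator has norm \<open>\<infinity>\<close>.
\<close>

definition op_norm_on :: "'a set \<Rightarrow> ('a \<Rightarrow> real) \<Rightarrow> ('b \<Rightarrow> real) \<Rightarrow> ('a \<Rightarrow> 'b) \<Rightarrow> ereal"
  where "op_norm_on S N M f = (SUP x\<in>{x\<in>S. N x \<le> 1}. ereal (M (f x)))"

text \<open>
  A finite-dimensional linear subspace \<open>Y\<close> of some vector space, with an arbitrary norm \<open>N\<close> on \<open>Y\<close>.
  Completeness is automatic.
\<close>

locale fin_dim_normed_space =
  vector_space scale
  for scale :: "'k::{real_normed_field, euclidean_space} \<Rightarrow> 'v::ab_group_add \<Rightarrow> 'v" +
  fixes Y :: "'v set" and N :: "'v \<Rightarrow> real"
  assumes fin_dim: "\<exists>B. finite B \<and> Y = span B"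
    and N_nonneg: "x \<in> Y \<Longrightarrow> 0 \<le> N x"
    and N_eq_0_iff: "x \<in> Y \<Longrightarrow> N x = 0 \<longleftrightarrow> x = 0"
    and N_triangle: "x \<in> Y \<Longrightarrow> y \<in> Y \<Longrightarrow> N (x + y) \<le> N x + N y"
    and N_scale: "x \<in> Y \<Longrightarrow> N (scale a x) = norm a * N x"

definition seq_scale :: "'k::times \<Rightarrow> (nat \<Rightarrow> 'k) \<Rightarrow> nat \<Rightarrow> 'k"
  where "seq_scale a v = (\<lambda>i. a * v i)"

text \<open>
  A definition cannot quantify over types, so the finite-dimensional spaces \<open>X \<subseteq> Y\<close> range over the
  subspaces of \<open>nat \<Rightarrow> 'k\<close>, with all norms on them. Up to isometry these are all
  finite-dimensional normed spaces; the lemma \<open>gurarii_space_extension\<close> below recovers the property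
  for \<open>X \<subseteq> Y\<close> inside an arbitrary vector space.
\<close>

definition gurarii_space ::
    "('k::{real_normed_field, euclidean_space} \<Rightarrow> 'g::banach \<Rightarrow> 'g) \<Rightarrow> bool"
  where "gurarii_space s \<longleftrightarrow>
    banach_space_over s \<and> separable_space (euclidean :: 'g topology) \<and>
    (\<forall>Y N X f \<epsilon>.
      fin_dim_normed_space seq_scale Y N \<and> module.subspace seq_scale X \<and> X \<subseteq> Y \<and>
      (0::real) < \<epsilon> \<and> isometry_on seq_scale s X N norm f \<longrightarrow>
      (\<exists>g. linear_map_on seq_scale s Y g \<and> inj_on g Y \<and> (\<forall>x\<in>X. g x = f x) \<and>
        op_norm_on Y N norm g * op_norm_on (g ` Y) norm N (inv_into Y g) < ereal (1 + \<epsilon>)))"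

lemma vector_space_seq_scale: "vector_space (seq_scale :: 'k::field \<Rightarrow> _)"
  by unfold_locales (auto simp: seq_scale_def fun_eq_iff algebra_simps)

lemma fin_dim_coordinates:
  fixes s :: "'k::field \<Rightarrow> 'v::ab_group_add \<Rightarrow> 'v"
  assumes "vector_space s" and "finite B"
  obtains \<phi> \<psi> where "Vector_Spaces.linear s seq_scale \<phi>" and "Vector_Spaces.linear seq_scale s \<psi>"
    and "\<And>x. x \<in> module.span s B \<Longrightarrow> \<psi> (\<phi> x) = x"
proof -
  interpret V: vector_space s by fact
  interpret F: vector_space "seq_scale :: 'k \<Rightarrow> _" by (rule vector_space_seq_scale)
  interpret P: vector_space_pair s "seq_scale :: 'k \<Rightarrow> _" ..
  interpret Q: vector_space_pair "seq_scale :: 'k \<Rightarrow> _" s ..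
  interpret R: vector_space_pair s s ..
  obtain C where C: "C \<subseteq> B" "V.independent C" "B \<subseteq> V.span C"
    by (rule V.maximal_independent_subset)
  have spanC: "V.span C = V.span B"
    using V.span_mono[OF C(1)] V.span_minimal[OF C(3) V.subspace_span] by (rule subset_antisym)
  have "finite C" using C assms finite_subset by blast
  then obtain b where b: "bij_betw b {..<card C} C"
    using ex_bij_betw_nat_finite[of C] unfolding atLeast0LessThan by blast
  define e :: "'v \<Rightarrow> nat \<Rightarrow> 'k"
    where "e c = (\<lambda>i. if i < card C \<and> b i = c then 1 else 0)" for c
  define \<phi> where "\<phi> = P.construct C e"
  define \<psi> where "\<psi> w = (\<Sum>i<card C. s (w i) (b i))" for w :: "nat \<Rightarrow> 'k"
  have lin1: "Vector_Spaces.linear s seq_scale \<phi>"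
    unfolding \<phi>_def by (rule P.linear_construct) (rule C)
  have lin2: "Vector_Spaces.linear seq_scale s \<psi>"
    unfolding \<psi>_def
    by unfold_locales
      (auto simp: V.scale_left_distrib sum.distrib V.scale_sum_right seq_scale_def)
  have base: "\<psi> (\<phi> c) = c" if "c \<in> C" for c
  proof -
    have "c \<in> b ` {..<card C}"
      using b that by (simp add: bij_betw_def)
    then obtain j where j: "j < card C" "b j = c"
      by blast
    have "(b i = c) = (i = j)" if "i < card C" for i
      using inj_on_eq_iff[OF bij_betw_imp_inj_on[OF b], of i j] j that by auto
    then have "\<psi> (e c) = (\<Sum>i<card C. if i = j then b i else 0)"
      unfolding \<psi>_def e_def by (intro sum.cong) auto
    also have "\<dots> = c" using j by simp
    finally show ?thesis
      unfolding \<phi>_def using P.construct_basis[OF C(2) that] by simp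
  qed
  have "Vector_Spaces.linear s s (\<psi> \<circ> \<phi>)"
    using lin1 lin2 by (rule Vector_Spaces.linear_compose)
  then have "(\<psi> \<circ> \<phi>) x = id x" if "x \<in> V.span C" for x
    by (rule R.linear_eq_on[OF _ V.linear_id that]) (simp add: base)
  then have "\<psi> (\<phi> x) = x" if "x \<in> V.span B" for x
    using that unfolding spanC by simp
  with lin1 lin2 show thesis
    by (rule that)
qed

lemma gurarii_space_extension:
  fixes s :: "'k::{real_normed_field, euclidean_space} \<Rightarrow> 'g::banach \<Rightarrow> 'g"
    and sV :: "'k \<Rightarrow> 'v::ab_group_add \<Rightarrow> 'v"
  assumes G: "gurarii_space s" and Y: "fin_dim_normed_space sV Y N"
    and X: "module.subspace sV X" "X \<subseteq> Y" and \<epsilon>: "(0::real) < \<epsilon>"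
    and f: "isometry_on sV s X N norm f"
  shows "\<exists>g. linear_map_on sV s Y g \<and> inj_on g Y \<and> (\<forall>x\<in>X. g x = f x) \<and>
    op_norm_on Y N norm g * op_norm_on (g ` Y) norm N (inv_into Y g) < ereal (1 + \<epsilon>)"
proof -
  interpret Y: fin_dim_normed_space sV Y N by fact
  interpret F: vector_space "seq_scale :: 'k \<Rightarrow> _" by (rule vector_space_seq_scale)
  obtain B where B: "finite B" "Y = Y.span B" using Y.fin_dim by blast
  have subY: "Y.subspace Y" unfolding B(2) by (rule Y.subspace_span)
  obtain \<phi> \<psi> where lin1: "Vector_Spaces.linear sV seq_scale \<phi>"
    and lin2: "Vector_Spaces.linear seq_scale sV \<psi>"
    and inv: "\<And>x. x \<in> Y \<Longrightarrow> \<psi> (\<phi> x) = x"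
    using fin_dim_coordinates[OF Y.vector_space_axioms B(1), folded B(2)] by blast
  interpret L1: Vector_Spaces.linear sV seq_scale \<phi> by (rule lin1)
  interpret L2: Vector_Spaces.linear seq_scale sV \<psi> by (rule lin2)
  let ?Y = "\<phi> ` Y" and ?N = "N \<circ> \<psi>" and ?X = "\<phi> ` X" and ?f = "f \<circ> \<psi>"
  have "\<exists>B. finite B \<and> ?Y = F.span B"
    using B(1) L1.span_image[of B, folded B(2)] by blast
  moreover have "(?N w = 0) = (w = 0)" if "w \<in> ?Y" for w
  proof -
    obtain x where x: "x \<in> Y" "w = \<phi> x" using \<open>w \<in> ?Y\<close> by blast
    have "\<phi> x = 0 \<longleftrightarrow> x = 0" using inv[OF x(1)] L1.zero L2.zero by auto
    then show ?thesis using x inv Y.N_eq_0_iff by simp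
  qed
  moreover have "0 \<le> ?N w" if "w \<in> ?Y" for w
    using that inv Y.N_nonneg by auto
  moreover have "?N (w + v) \<le> ?N w + ?N v" if "w \<in> ?Y" "v \<in> ?Y" for w v
    using that inv Y.N_triangle by (auto simp: L2.add)
  moreover have "?N (seq_scale a w) = norm a * ?N w" if "w \<in> ?Y" for a w
    using that inv Y.N_scale by (auto simp: L2.scale)
  ultimately have "fin_dim_normed_space seq_scale ?Y ?N"
    by (intro fin_dim_normed_space.intro fin_dim_normed_space_axioms.intro F.vector_space_axioms)
  moreover have "F.subspace ?X" using X by (rule_tac L1.subspace_image)
  moreover have "isometry_on seq_scale s ?X ?N norm ?f"
    using f X(2) by (auto simp: isometry_on_def linear_map_on_def L2.add L2.scale inv subset_iff)
  moreover have "?X \<subseteq> ?Y" using X by blast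
  ultimately obtain g where g: "linear_map_on seq_scale s ?Y g" "inj_on g ?Y"
    "\<forall>x\<in>?X. g x = ?f x"
    "op_norm_on ?Y ?N norm g * op_norm_on (g ` ?Y) norm ?N (inv_into ?Y g) < ereal (1 + \<epsilon>)"
    using G[unfolded gurarii_space_def, THEN conjunct2, THEN conjunct2, rule_format,
        of ?Y ?N ?X \<epsilon> ?f] \<epsilon> by blast
  let ?g = "g \<circ> \<phi>"
  have inj: "inj_on ?g Y"
    using g(2) inv by (intro comp_inj_on) (auto intro: inj_on_inverseI)
  have lin: "linear_map_on sV s Y ?g"
    using g(1) by (auto simp: linear_map_on_def L1.add L1.scale)
  have ext: "\<forall>x\<in>X. ?g x = f x" using g(3) X(2) inv by auto
  have "{w \<in> ?Y. ?N w \<le> 1} = \<phi> ` {x \<in> Y. N x \<le> 1}" using inv by auto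
  then have n1: "op_norm_on ?Y ?N norm g = op_norm_on Y N norm ?g"
    by (simp add: op_norm_on_def image_image)
  have "?N (inv_into ?Y g z) = N (inv_into Y ?g z)" if "z \<in> ?g ` Y" for z
  proof -
    obtain x where x: "x \<in> Y" "z = ?g x" using \<open>z \<in> ?g ` Y\<close> by blast
    have "inv_into ?Y g z = \<phi> x" using g(2) x by simp
    moreover have "inv_into Y ?g z = x" using inv_into_f_f[OF inj x(1)] x(2) by simp
    ultimately show ?thesis using inv x by simp
  qed
  then have n2: "op_norm_on (g ` ?Y) norm ?N (inv_into ?Y g)
      = op_norm_on (?g ` Y) norm N (inv_into Y ?g)"
    unfolding op_norm_on_def image_comp by (intro SUP_cong) auto
  show ?thesis using lin inj ext g(4) unfolding n1 n2 by (intro exI[of _ ?g] conjI)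
qed

end

theory Submission
  imports Defs
begin

text \<open>
  The embedding is the limit of linear maps \<open>F n\<close> from finite-dimensional subspaces \<open>E n\<close>, whose
  union is dense in \<open>X\<close>, into the Gurarii space \<open>G\<close>. Each \<open>F n\<close> is only an isometry up to a
  relative error \<open>\<epsilon> n = 2\<^sup>-\<^sup>n\<close>; the Gurarii property extends an exact isometry only with a small
  distortion, so an extension of \<open>F n\<close> to \<open>E (n + 1)\<close> would retain its error. Instead the error is
  reduced at every step, at the price of moving the previous map slightly.

  The correction step \<open>almost_isometry_improve\<close> is the heart of the argument. Let \<open>f : E \<rightarrow> G\<close> be an
  isometry up to \<open>\<epsilon>\<close> and let \<open>F \<supseteq> E\<close> be finite-dimensional. The space \<open>F \<times> f(E)\<close> carries a norm
  which restricts to the given norms on \<open>F\<close> and on \<open>f(E)\<close> and in which every \<open>w \<in> E\<close> is within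
  \<open>\<epsilon> \<parallel>w\<parallel>\<close> of its image \<open>f w\<close>. So inside this larger space \<open>f\<close> is a small
  perturbation of an honest isometric inclusion. The inclusion of \<open>f(E)\<close> into \<open>G\<close> is exactly
  isometric, hence the Gurarii property extends it to a map \<open>h\<close> of \<open>F \<times> f(E)\<close> into \<open>G\<close> of distortion
  as small as desired. Restricted to \<open>F\<close>, this \<open>h\<close> is the improved map: on \<open>E\<close> it differs from \<open>f\<close>
  by about \<open>\<epsilon>\<close>, because \<open>w\<close> and \<open>f w\<close> are close in the amalgam.

  Consecutive maps thus differ at \<open>w \<in> E n\<close> by at most \<open>2 (\<epsilon> n) \<parallel>w\<parallel>\<close>, which is summable, so the maps
  converge pointwise on the union of the \<open>E n\<close>. As \<open>\<epsilon> n\<close> tends to \<open>0\<close>, the limit is an exact isometry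
  (\<open>almost_isometries_limit\<close>), and it extends to the closure \<open>X\<close> because \<open>G\<close> is complete
  (\<open>isometry_extend_dense\<close>).
\<close>

section \<open>Extension of isometries with small distortion\<close>

text \<open>
  The error is measured against \<open>N x\<close> on both sides, instead of by bounds on \<open>\<parallel>f\<parallel>\<close> and \<open>\<parallel>f\<inverse>\<parallel>\<close>.
  This is the form in which \<open>\<epsilon>\<close> enters the triangle inequalities for the amalgamated norm.
\<close>

definition almost_isometry_on ::
    "('k \<Rightarrow> 'a::plus \<Rightarrow> 'a) \<Rightarrow> ('k \<Rightarrow> 'b::real_normed_vector \<Rightarrow> 'b) \<Rightarrow> 'a set \<Rightarrow> ('a \<Rightarrow> real)
      \<Rightarrow> real \<Rightarrow> ('a \<Rightarrow> 'b) \<Rightarrow> bool"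
  where "almost_isometry_on s1 s2 S N \<epsilon> f \<longleftrightarrow>
    linear_map_on s1 s2 S f \<and> (\<forall>x\<in>S. \<bar>norm (f x) - N x\<bar> \<le> \<epsilon> * N x)"

lemma le_op_norm_on: "x \<in> S \<Longrightarrow> N x \<le> 1 \<Longrightarrow> ereal (M (f x)) \<le> op_norm_on S N M f"
  unfolding op_norm_on_def by (rule SUP_upper) simp

lemma (in fin_dim_normed_space) subspace_Y: "subspace Y"
  using fin_dim subspace_span by auto

text \<open>
  If \<open>Y \<noteq> {0}\<close>, then \<open>A\<close> and \<open>B\<close> are \<open>\<parallel>g\<parallel>\<close> and \<open>\<parallel>g\<inverse>\<parallel>\<close>. Both are positive, so their product can
  be finite only if each of them is, which allows the passage from extended reals to reals.
\<close>

lemma gurarii_space_two_sided_bounds: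
  fixes s :: "'k::{real_normed_field, euclidean_space} \<Rightarrow> 'g::banach \<Rightarrow> 'g"
    and sV :: "'k \<Rightarrow> 'v::ab_group_add \<Rightarrow> 'v"
  assumes G: "gurarii_space s" and Y: "fin_dim_normed_space sV Y N"
    and X: "module.subspace sV X" "X \<subseteq> Y" and \<epsilon>: "(0::real) < \<epsilon>"
    and f: "isometry_on sV s X N norm f"
  obtains g A B where "linear_map_on sV s Y g" "\<And>x. x \<in> X \<Longrightarrow> g x = f x" "0 < A" "0 < B"
    "A * B < 1 + \<epsilon>" "\<And>x. x \<in> Y \<Longrightarrow> norm (g x) \<le> A * N x" "\<And>x. x \<in> Y \<Longrightarrow> N x \<le> B * norm (g x)"
proof -
  interpret Y: fin_dim_normed_space sV Y N by fact
  interpret G: banach_space_over s using G by (simp add: gurarii_space_def)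
  have X0: "0 \<in> X" using X(1) by (rule Y.subspace_0)
  have Y0: "0 \<in> Y" using X0 X(2) by blast
  obtain g where g: "linear_map_on sV s Y g" "inj_on g Y" "\<forall>x\<in>X. g x = f x"
    "op_norm_on Y N norm g * op_norm_on (g ` Y) norm N (inv_into Y g) < ereal (1 + \<epsilon>)"
    using gurarii_space_extension[OF G Y X \<epsilon> f] by blast
  define a where "a = op_norm_on Y N norm g"
  define b where "b = op_norm_on (g ` Y) norm N (inv_into Y g)"
  have g_scale: "g (sV c x) = s c (g x)" if "x \<in> Y" for c x
    using g(1) that by (simp add: linear_map_on_def)
  have g0: "g 0 = 0" using g_scale[OF Y0, of 0] by simp
  have N0: "N 0 = 0" using Y.N_eq_0_iff[OF Y0] by simp
  have norm_s: "norm (s (of_real r) v) = \<bar>r\<bar> * norm v" for r v by (simp add: G.norm_scale)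
  have Y_scale: "sV c x \<in> Y" if "x \<in> Y" for c x
    using Y.subspace_scale[OF Y.subspace_Y that] .
  have pos: "0 < N x" "0 < norm (g x)" if "x \<in> Y" "x \<noteq> 0" for x
  proof -
    show "0 < N x" using Y.N_nonneg[OF that(1)] Y.N_eq_0_iff[OF that(1)] that(2) by simp
    have "g x \<noteq> g 0" using inj_onD[OF g(2)] that Y0 by blast
    then show "0 < norm (g x)" using g0 by simp
  qed
  have le_a: "ereal (norm (g x) / N x) \<le> a" if "x \<in> Y" "x \<noteq> 0" for x
  proof -
    let ?y = "sV (of_real (inverse (N x))) x"
    have "N ?y \<le> 1" using Y.N_scale[OF that(1)] pos(1)[OF that] by (simp del: of_real_inverse)
    moreover have "norm (g ?y) = norm (g x) / N x"
      using pos(1)[OF that] by (simp add: g_scale that(1) norm_s divide_inverse mult.commute del: of_real_inverse)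
    ultimately show ?thesis
      using le_op_norm_on[of ?y Y N norm g] Y_scale[OF that(1)] by (simp add: a_def)
  qed
  have le_b: "ereal (N x / norm (g x)) \<le> b" if "x \<in> Y" "x \<noteq> 0" for x
  proof -
    let ?y = "sV (of_real (inverse (norm (g x)))) x"
    have yY: "?y \<in> Y" by (rule Y_scale) fact
    have "norm (g ?y) \<le> 1" using pos(2)[OF that] by (simp add: g_scale that(1) norm_s del: of_real_inverse)
    moreover have "N (inv_into Y g (g ?y)) = N x / norm (g x)"
      unfolding inv_into_f_f[OF g(2) yY] using Y.N_scale[OF that(1)] pos(2)[OF that]
      by (simp add: divide_inverse mult.commute del: of_real_inverse)
    ultimately show ?thesis
      using le_op_norm_on[of "g ?y" "g ` Y" norm N "inv_into Y g"] yY by (simp add: b_def)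
  qed
  show thesis
  proof (cases "Y = {0}")
    case True
    show thesis
      by (rule that[of g 1 1]) (use True g g0 N0 \<epsilon> in auto)
  next
    case False
    then obtain y where y: "y \<in> Y" "y \<noteq> 0" using Y0 by blast
    have ab: "0 < a" "0 < b"
      using le_a[OF y] le_b[OF y] pos[OF y] by (metis divide_pos_pos ereal_less(2) less_le_trans)+
    have lt: "a * b < ereal (1 + \<epsilon>)" using g(4) by (simp add: a_def b_def)
    have "a \<noteq> \<infinity>" "b \<noteq> \<infinity>" using ab lt by (auto split: if_splits)
    then obtain A B where AB: "a = ereal A" "b = ereal B"
      using ab by (cases a; cases b) auto
    show thesis
    proof (rule that[of g A B])
      show "norm (g x) \<le> A * N x" if "x \<in> Y" for x
        using le_a[OF that] pos[of x] that g0 N0 by (cases "x = 0") (auto simp: AB field_simps)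
      show "N x \<le> B * norm (g x)" if "x \<in> Y" for x
        using le_b[OF that] pos[of x] that g0 N0 by (cases "x = 0") (auto simp: AB field_simps)
    qed (use g ab lt AB in auto)
  qed
qed

text \<open>
  A bound on the product \<open>A * B\<close> does not bound the factors. If \<open>X\<close> contains a nonzero vector, then \<open>g\<close>
  preserves its norm, so \<open>A\<close> and \<open>B\<close> are at least \<open>1\<close> and hence at most \<open>1 + \<delta>\<close>. If \<open>X = {0}\<close>, every linear
  map extends \<open>f\<close>, so \<open>g\<close> may be divided by \<open>A\<close>; this turns the bounds into \<open>1\<close> and \<open>A * B\<close>.
\<close>

lemma gurarii_space_extend_almost_isometry:
  fixes s :: "'k::{real_normed_field, euclidean_space} \<Rightarrow> 'g::banach \<Rightarrow> 'g"
    and sV :: "'k \<Rightarrow> 'v::ab_group_add \<Rightarrow> 'v"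
  assumes G: "gurarii_space s" and Y: "fin_dim_normed_space sV Y N"
    and X: "module.subspace sV X" "X \<subseteq> Y" and \<delta>: "(0::real) < \<delta>"
    and f: "isometry_on sV s X N norm f"
  obtains g where "almost_isometry_on sV s Y N \<delta> g" "\<And>x. x \<in> X \<Longrightarrow> g x = f x"
proof -
  interpret Y: fin_dim_normed_space sV Y N by fact
  interpret G: banach_space_over s using G by (simp add: gurarii_space_def)
  obtain g A B where g: "linear_map_on sV s Y g" "\<And>x. x \<in> X \<Longrightarrow> g x = f x" "0 < A" "0 < B"
    "A * B < 1 + \<delta>" and gA: "\<And>x. x \<in> Y \<Longrightarrow> norm (g x) \<le> A * N x"
    and gB: "\<And>x. x \<in> Y \<Longrightarrow> N x \<le> B * norm (g x)"
    using gurarii_space_two_sided_bounds[OF G Y X \<delta> f] by blast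
  have almost: "\<bar>u - v\<bar> \<le> \<delta> * v" if "u \<le> (1 + \<delta>) * v" "v \<le> (1 + \<delta>) * u" for u v :: real
  proof -
    have "v - u \<le> \<delta> * v"
    proof (cases "u \<le> v")
      case True
      then have "\<delta> * u \<le> \<delta> * v" using \<delta> by simp
      then show ?thesis using that(2) by (simp add: algebra_simps)
    next
      case False
      have "0 \<le> v"
      proof (rule ccontr)
        assume "\<not> 0 \<le> v"
        then have "\<delta> * v < 0" using \<delta> by (simp add: mult_pos_neg)
        with False that(1) show False by (simp add: algebra_simps)
      qed
      then have "0 \<le> \<delta> * v" using \<delta> by simp
      then show ?thesis using False by linarith
    qed
    then show ?thesis using that(1) by (simp add: abs_le_iff algebra_simps)
  qed
  show thesis
  proof (cases "X \<subseteq> {0}")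
    case False
    then obtain x where x: "x \<in> X" "x \<noteq> 0" by blast
    then have "x \<in> Y" using X(2) by blast
    then have Nx: "0 < N x" using Y.N_nonneg[of x] Y.N_eq_0_iff[of x] x(2) by simp
    have "norm (g x) = N x" using f g(2) x(1) by (simp add: isometry_on_def)
    then have AB: "1 \<le> A" "1 \<le> B" using gA[OF \<open>x \<in> Y\<close>] gB[OF \<open>x \<in> Y\<close>] Nx by auto
    have "A * 1 \<le> A * B" "1 * B \<le> A * B" using AB g(3,4) by (intro mult_left_mono mult_right_mono; simp)+
    then have AB': "A \<le> 1 + \<delta>" "B \<le> 1 + \<delta>" using g(5) by auto
    have "\<bar>norm (g x) - N x\<bar> \<le> \<delta> * N x" if "x \<in> Y" for x
    proof (rule almost)
      show "norm (g x) \<le> (1 + \<delta>) * N x"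
        using gA[OF that] mult_right_mono[OF AB'(1) Y.N_nonneg[OF that]] by linarith
      show "N x \<le> (1 + \<delta>) * norm (g x)"
        using gB[OF that] mult_right_mono[OF AB'(2) norm_ge_zero[of "g x"]] by linarith
    qed
    then show thesis using that[of g] g(1,2) by (simp add: almost_isometry_on_def)
  next
    case True
    let ?h = "\<lambda>x. s (of_real (inverse A)) (g x)"
    have norm_h: "norm (?h x) = norm (g x) / A" for x
      using g(3) by (simp add: G.norm_scale divide_inverse mult.commute del: of_real_inverse)
    have "linear_map_on sV s Y ?h"
      using g(1) by (simp add: linear_map_on_def G.scale_right_distrib mult.commute del: of_real_inverse)
    moreover have "\<bar>norm (?h x) - N x\<bar> \<le> \<delta> * N x" if "x \<in> Y" for x
    proof (rule almost)
      have "norm (?h x) \<le> N x" using gA[OF that] g(3) by (simp only: norm_h) (simp add: field_simps)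
      moreover have "0 \<le> \<delta> * N x" using \<delta> Y.N_nonneg[OF that] by simp
      ultimately show "norm (?h x) \<le> (1 + \<delta>) * N x" by (simp only: distrib_right)
      have "N x \<le> (A * B) * norm (?h x)" using gB[OF that] g(3) by (simp only: norm_h) simp
      also have "\<dots> \<le> (1 + \<delta>) * norm (?h x)" using g(5) by (intro mult_right_mono) auto
      finally show "N x \<le> (1 + \<delta>) * norm (?h x)" .
    qed
    moreover have "?h x = f x" if "x \<in> X" for x
    proof -
      have "x = 0" "x \<in> Y" using that True X(2) by auto
      then have "norm (f x) = 0" using f that Y.N_eq_0_iff by (simp add: isometry_on_def)
      then show ?thesis using g(2)[OF that] by simp
    qed
    ultimately show thesis using that[of ?h] by (simp add: almost_isometry_on_def)
  qed
qed

section \<open>The amalgamated norm\<close>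

locale almost_isometry =
  X: banach_space_over sX + G: banach_space_over sG
  for sX :: "'k::{real_normed_field, euclidean_space} \<Rightarrow> 'x::banach \<Rightarrow> 'x"
    and sG :: "'k \<Rightarrow> 'g::banach \<Rightarrow> 'g" +
  fixes E :: "'x set" and \<epsilon> :: real and f :: "'x \<Rightarrow> 'g"
  assumes E: "X.subspace E" and \<epsilon>: "0 < \<epsilon>" and f: "almost_isometry_on sX sG E norm \<epsilon> f"
begin

sublocale XG: vector_space_prod sX sG ..

abbreviation sZ :: "'k \<Rightarrow> 'x \<times> 'g \<Rightarrow> 'x \<times> 'g" where "sZ \<equiv> XG.scale"

text \<open>
  A pair \<open>(x, y)\<close> stands for the formal sum \<open>x + y\<close>. For each \<open>w \<in> E\<close> it can be rewritten as
  \<open>(x - w) + (y + f w) + (w - f w)\<close>. The last summand is charged \<open>\<epsilon> \<parallel>w\<parallel>\<close>, the distance wanted between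
  \<open>w\<close> and \<open>f w\<close>. The infimum over all \<open>w\<close> is the largest seminorm that is at most the given norm on each factor
  and at most \<open>\<epsilon> \<parallel>w\<parallel>\<close> on each \<open>w - f w\<close>.
\<close>

definition split_cost :: "'x \<times> 'g \<Rightarrow> 'x \<Rightarrow> real"
  where "split_cost z w = norm (fst z - w) + norm (snd z + f w) + \<epsilon> * norm w"

definition amalgam_norm :: "'x \<times> 'g \<Rightarrow> real"
  where "amalgam_norm z = (INF w\<in>E. split_cost z w)"

lemma f_add: "u \<in> E \<Longrightarrow> v \<in> E \<Longrightarrow> f (u + v) = f u + f v"
  and f_scale: "u \<in> E \<Longrightarrow> f (sX a u) = sG a (f u)"
  and f_close: "u \<in> E \<Longrightarrow> \<bar>norm (f u) - norm u\<bar> \<le> \<epsilon> * norm u"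
  using f by (auto simp: almost_isometry_on_def linear_map_on_def)

lemma f_0: "f 0 = 0"
  using f_scale[of 0 0] X.subspace_0[OF E] by simp

lemma split_cost_nonneg: "0 \<le> split_cost z w"
  using \<epsilon> by (simp add: split_cost_def)

lemma amalgam_norm_le: "w \<in> E \<Longrightarrow> amalgam_norm z \<le> split_cost z w"
  unfolding amalgam_norm_def
  by (rule cINF_lower) (auto intro!: bdd_belowI[of _ 0] split_cost_nonneg)

lemma le_amalgam_norm: "(\<And>w. w \<in> E \<Longrightarrow> c \<le> split_cost z w) \<Longrightarrow> c \<le> amalgam_norm z"
  unfolding amalgam_norm_def using X.subspace_0[OF E] by (intro cINF_greatest) auto

lemma amalgam_norm_nonneg: "0 \<le> amalgam_norm z"
  by (rule le_amalgam_norm) (rule split_cost_nonneg)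

lemma amalgam_norm_triangle: "amalgam_norm (z + z') \<le> amalgam_norm z + amalgam_norm z'"
proof -
  have "amalgam_norm (z + z') \<le> split_cost z w + split_cost z' w'" if "w \<in> E" "w' \<in> E" for w w'
  proof -
    have "norm (fst (z + z') - (w + w')) \<le> norm (fst z - w) + norm (fst z' - w')"
      using norm_triangle_ineq[of "fst z - w" "fst z' - w'"] by (simp add: algebra_simps)
    moreover have "norm (snd (z + z') + f (w + w')) \<le> norm (snd z + f w) + norm (snd z' + f w')"
      using norm_triangle_ineq[of "snd z + f w" "snd z' + f w'"]
      by (simp add: f_add that algebra_simps)
    moreover have "\<epsilon> * norm (w + w') \<le> \<epsilon> * norm w + \<epsilon> * norm w'"
      using mult_left_mono[OF norm_triangle_ineq[of w w'], of \<epsilon>] \<epsilon> by (simp add: distrib_left)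
    ultimately have "split_cost (z + z') (w + w') \<le> split_cost z w + split_cost z' w'"
      by (simp only: split_cost_def)
    then show ?thesis
      using amalgam_norm_le[OF X.subspace_add[OF E that]] order_trans by blast
  qed
  then have "amalgam_norm (z + z') - split_cost z w \<le> amalgam_norm z'" if "w \<in> E" for w
    using that by (intro le_amalgam_norm) (simp add: algebra_simps)
  then have "amalgam_norm (z + z') - amalgam_norm z' \<le> amalgam_norm z"
    by (intro le_amalgam_norm) (simp add: algebra_simps)
  then show ?thesis by simp
qed

lemma amalgam_norm_0: "amalgam_norm 0 = 0"
  using amalgam_norm_le[OF X.subspace_0[OF E], of 0] amalgam_norm_nonneg[of 0]
  by (simp add: split_cost_def f_0)

text \<open>
  The substitution \<open>w \<mapsto> a w\<close> gives one inequality; the other is the same inequality for the inverse scalar.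
\<close>

lemma amalgam_norm_scale: "amalgam_norm (sZ a z) = norm a * amalgam_norm z"
proof (cases "a = 0")
  case True
  then show ?thesis by (simp add: amalgam_norm_0)
next
  case False
  have le: "amalgam_norm (sZ c v) \<le> norm c * amalgam_norm v" if "c \<noteq> 0" for c v
  proof -
    have "amalgam_norm (sZ c v) / norm c \<le> amalgam_norm v"
    proof (rule le_amalgam_norm)
      fix w assume w: "w \<in> E"
      have "split_cost (sZ c v) (sX c w) = norm c * split_cost v w"
        by (simp add: split_cost_def XG.scale_def f_scale[OF w] X.norm_scale G.norm_scale
            distrib_left flip: X.scale_right_diff_distrib G.scale_right_distrib)
      then show "amalgam_norm (sZ c v) / norm c \<le> split_cost v w"
        using amalgam_norm_le[OF X.subspace_scale[OF E w, of c], of "sZ c v"] that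
        by (simp add: field_simps)
    qed
    then show ?thesis using that by (simp add: field_simps)
  qed
  have "amalgam_norm z \<le> amalgam_norm (sZ a z) / norm a"
    using le[of "inverse a" "sZ a z"] False by (simp add: norm_inverse divide_inverse mult.commute)
  then have "norm a * amalgam_norm z \<le> amalgam_norm (sZ a z)" using False by (simp add: field_simps)
  then show ?thesis using le[OF False, of z] by simp
qed

text \<open>
  A nonzero \<open>w\<close> does not make \<open>x\<close> cheaper: the distortion of \<open>f\<close> gives
  \<open>\<parallel>f w\<parallel> + \<epsilon> \<parallel>w\<parallel> \<ge> \<parallel>w\<parallel>\<close>, so the cost is at least \<open>\<parallel>x - w\<parallel> + \<parallel>w\<parallel>\<close>.
\<close>

lemma amalgam_norm_left: "amalgam_norm (x, 0) = norm x"
proof (rule antisym)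
  show "amalgam_norm (x, 0) \<le> norm x"
    using amalgam_norm_le[OF X.subspace_0[OF E], of "(x, 0)"] by (simp add: split_cost_def f_0)
  show "norm x \<le> amalgam_norm (x, 0)"
  proof (rule le_amalgam_norm)
    fix w assume "w \<in> E"
    then show "norm x \<le> split_cost (x, 0) w"
      using f_close[of w] norm_triangle_sub[of x w] by (simp add: split_cost_def)
  qed
qed

text \<open>
  Symmetrically, \<open>\<parallel>w\<parallel> + \<epsilon> \<parallel>w\<parallel> \<ge> \<parallel>f w\<parallel>\<close>, so the cost is at least \<open>\<parallel>y + f w\<parallel> + \<parallel>f w\<parallel>\<close>.
\<close>

lemma amalgam_norm_right: "amalgam_norm (0, y) = norm y"
proof (rule antisym)
  show "amalgam_norm (0, y) \<le> norm y"
    using amalgam_norm_le[OF X.subspace_0[OF E], of "(0, y)"] by (simp add: split_cost_def f_0)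
  show "norm y \<le> amalgam_norm (0, y)"
  proof (rule le_amalgam_norm)
    fix w assume "w \<in> E"
    then show "norm y \<le> split_cost (0, y) w"
      using f_close[of w] norm_triangle_ineq4[of "y + f w" "f w"] by (simp add: split_cost_def)
  qed
qed

text \<open>The pair \<open>(w, - f w)\<close> is the formal difference of \<open>w\<close> and its image.\<close>

lemma amalgam_norm_graph: "w \<in> E \<Longrightarrow> amalgam_norm (w, - f w) \<le> \<epsilon> * norm w"
  using amalgam_norm_le[of w "(w, - f w)"] by (simp add: split_cost_def)

text \<open>
  The term \<open>\<epsilon> * norm w\<close> keeps the first coordinate under control: a cheap splitting needs \<open>w\<close> close to
  \<open>fst z\<close> and close to \<open>0\<close> at once. Once the first coordinate vanishes, the norm is that of \<open>G\<close>.
\<close>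

lemma amalgam_norm_eq_0_iff: "amalgam_norm z = 0 \<longleftrightarrow> z = 0"
proof
  assume N: "amalgam_norm z = 0"
  have "min 1 \<epsilon> * norm (fst z) \<le> amalgam_norm z"
  proof (rule le_amalgam_norm)
    fix w assume "w \<in> E"
    have "min 1 \<epsilon> * norm (fst z) \<le> min 1 \<epsilon> * norm (fst z - w) + min 1 \<epsilon> * norm w"
      using mult_left_mono[OF norm_triangle_sub[of "fst z" w], of "min 1 \<epsilon>"] \<epsilon>
      by (simp add: distrib_left algebra_simps)
    also have "\<dots> \<le> 1 * norm (fst z - w) + \<epsilon> * norm w"
      by (intro add_mono mult_right_mono) auto
    finally show "min 1 \<epsilon> * norm (fst z) \<le> split_cost z w"
      by (simp only: split_cost_def) (smt (verit) norm_ge_zero)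
  qed
  then have "fst z = 0" using N \<epsilon> by (simp add: mult_le_0_iff min_le_iff_disj)
  then have "amalgam_norm z = norm (snd z)" using amalgam_norm_right[of "snd z"] by (metis prod.collapse)
  then show "z = 0" using N \<open>fst z = 0\<close> by (simp add: prod_eq_iff)
qed (simp add: amalgam_norm_0)

lemma fin_dim_normed_space_amalgam:
  assumes "finite B" "finite C"
  shows "fin_dim_normed_space sZ (X.span B \<times> G.span C) amalgam_norm"
proof (intro fin_dim_normed_space.intro fin_dim_normed_space_axioms.intro XG.p.vector_space_axioms)
  have "XG.p.span (B \<times> {0} \<union> {0} \<times> C) = X.span B \<times> G.span C"
    unfolding XG.p.span_Un XG.span_Times_sing1 XG.span_Times_sing2 by force
  then show "\<exists>D. finite D \<and> X.span B \<times> G.span C = XG.p.span D"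
    using assms by (intro exI[of _ "B \<times> {0} \<union> {0} \<times> C"]) auto
qed (auto simp: amalgam_norm_nonneg amalgam_norm_triangle amalgam_norm_scale amalgam_norm_eq_0_iff)

text \<open>
  The space amalgamated is \<open>F \<times> H\<close> with \<open>H\<close> the span of the images of the generators of \<open>E\<close>; this
  makes \<open>H\<close> visibly a finite-dimensional subspace, and it
  contains \<open>f(E)\<close> since \<open>f\<close> is linear on \<open>E\<close>. The first error \<open>\<epsilon>\<close> survives only in the distance from \<open>f\<close>; the distortion of \<open>g\<close> is the freely chosen \<open>\<delta>\<close>.
\<close>

lemma almost_isometry_improve:
  assumes "gurarii_space sG" and "0 < \<delta>" and E_eq: "E = X.span C" and "finite B" and "C \<subseteq> B"
  obtains g where "almost_isometry_on sX sG (X.span B) norm \<delta> g"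
    and "\<And>w. w \<in> E \<Longrightarrow> norm (g w - f w) \<le> (1 + \<delta>) * (\<epsilon> * norm w)"
proof -
  let ?F = "X.span B" and ?H = "G.span (f ` C)"
  have "finite C" using assms finite_subset by blast
  then have Z: "fin_dim_normed_space sZ (?F \<times> ?H) amalgam_norm"
    using \<open>finite B\<close> by (intro fin_dim_normed_space_amalgam) auto
  have H: "XG.p.subspace ({0} \<times> ?H)"
    by (rule XG.subspace_Times[OF X.subspace_single_0 G.subspace_span])
  have sub: "{0} \<times> ?H \<subseteq> ?F \<times> ?H" using X.span_zero by auto
  have iso: "isometry_on sZ sG ({0} \<times> ?H) amalgam_norm norm snd"
    by (auto simp: isometry_on_def linear_map_on_def XG.scale_def amalgam_norm_right)
  obtain h where h: "almost_isometry_on sZ sG (?F \<times> ?H) amalgam_norm \<delta> h"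
    and h_snd: "\<And>z. z \<in> {0} \<times> ?H \<Longrightarrow> h z = snd z"
    using gurarii_space_extend_almost_isometry[OF assms(1) Z H sub \<open>0 < \<delta>\<close> iso] by blast
  have h_add: "h (z + z') = h z + h z'" if "z \<in> ?F \<times> ?H" "z' \<in> ?F \<times> ?H" for z z'
    using h that unfolding almost_isometry_on_def linear_map_on_def by blast
  have h_scale: "h (sZ a z) = sG a (h z)" if "z \<in> ?F \<times> ?H" for a z
    using h that unfolding almost_isometry_on_def linear_map_on_def by blast
  have h_close: "\<bar>norm (h z) - amalgam_norm z\<bar> \<le> \<delta> * amalgam_norm z" if "z \<in> ?F \<times> ?H" for z
    using h that unfolding almost_isometry_on_def by blast
  have left: "(x, 0) \<in> ?F \<times> ?H" if "x \<in> ?F" for x using that G.span_zero by auto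
  have "almost_isometry_on sX sG ?F norm \<delta> (\<lambda>x. h (x, 0))"
    unfolding almost_isometry_on_def linear_map_on_def
  proof (intro conjI ballI allI)
    show "h (x + y, 0) = h (x, 0) + h (y, 0)" if "x \<in> ?F" "y \<in> ?F" for x y
      using h_add[OF left[OF that(1)] left[OF that(2)]] by simp
    show "h (sX a x, 0) = sG a (h (x, 0))" if "x \<in> ?F" for a x
      using h_scale[OF left[OF that], of a] by (simp add: XG.scale_def)
    show "\<bar>norm (h (x, 0)) - norm x\<bar> \<le> \<delta> * norm x" if "x \<in> ?F" for x
      using h_close[OF left[OF that]] by (simp add: amalgam_norm_left)
  qed
  moreover have "norm (h (w, 0) - f w) \<le> (1 + \<delta>) * (\<epsilon> * norm w)" if w: "w \<in> E" for w
  proof -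
    have wF: "w \<in> ?F" using w E_eq X.span_mono[OF \<open>C \<subseteq> B\<close>] by blast
    have "X.subspace {v \<in> E. f v \<in> ?H}"
      unfolding X.subspace_def
      by (auto simp: f_0 f_add f_scale G.span_zero G.span_add G.span_scale
          intro: X.subspace_0[OF E] X.subspace_add[OF E] X.subspace_scale[OF E])
    moreover have "C \<subseteq> {v \<in> E. f v \<in> ?H}"
      unfolding E_eq by (auto intro: X.span_base G.span_base)
    ultimately have fw: "f w \<in> ?H"
      using X.span_minimal w unfolding E_eq by blast
    then have fw': "- f w \<in> ?H" by (rule G.span_neg)
    have "h (w, 0) = h ((w, - f w) + (0, f w))" by simp
    also have "\<dots> = h (w, - f w) + f w"
      using fw fw' wF X.span_zero by (subst h_add) (auto simp: h_snd)
    finally have "norm (h (w, 0) - f w) = norm (h (w, - f w))" by simp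
    also have "\<dots> \<le> (1 + \<delta>) * amalgam_norm (w, - f w)"
      using h_close[of "(w, - f w)"] wF fw' by (simp add: algebra_simps abs_le_iff)
    also have "\<dots> \<le> (1 + \<delta>) * (\<epsilon> * norm w)"
      using amalgam_norm_graph[OF w] \<open>0 < \<delta>\<close> by (intro mult_left_mono) auto
    finally show ?thesis .
  qed
  ultimately show thesis using that by blast
qed

end

section \<open>Limits of almost isometries\<close>

lemma (in banach_space_over) bounded_linear_scale: "bounded_linear (scale a)"
proof (rule bounded_linear_intro[where K = "norm a"])
  show "scale a (r *\<^sub>R x) = r *\<^sub>R scale a x" for r x
    by (simp add: mult.commute flip: scale_of_real)
qed (simp_all add: scale_right_distrib norm_scale mult.commute)

text \<open>
  An isometry is uniformly continuous, hence extends continuously to the closure. Linearity and the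
  preservation of the norm are identities between continuous functions, so they hold there too.
\<close>

lemma isometry_extend_dense:
  fixes sX :: "'k::{real_normed_field, euclidean_space} \<Rightarrow> 'x::banach \<Rightarrow> 'x"
    and sG :: "'k \<Rightarrow> 'g::banach \<Rightarrow> 'g"
  assumes "banach_space_over sX" and "banach_space_over sG"
    and S: "module.subspace sX S" "closure S = UNIV" and L: "isometry_on sX sG S norm norm L"
  obtains f where "isometry_on sX sG UNIV norm norm f"
proof -
  interpret X: banach_space_over sX by fact
  interpret G: banach_space_over sG by fact
  have L_add: "L (x + y) = L x + L y" if "x \<in> S" "y \<in> S" for x y
    using L that by (simp add: isometry_on_def linear_map_on_def)
  have L_scale: "L (sX a x) = sG a (L x)" if "x \<in> S" for a x
    using L that by (simp add: isometry_on_def linear_map_on_def)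
  have L_norm: "norm (L x) = norm x" if "x \<in> S" for x
    using L that by (simp add: isometry_on_def)
  have "dist (L x) (L y) = dist x y" if "x \<in> S" "y \<in> S" for x y
  proof -
    have d: "x - y \<in> S" by (rule X.subspace_diff[OF S(1) that])
    then have "L x = L (x - y) + L y" using L_add[OF d that(2)] by simp
    then show ?thesis using L_norm[OF d] by (simp add: dist_norm)
  qed
  then have "uniformly_continuous_on S L"
    unfolding uniformly_continuous_on_def by metis
  then obtain f where f: "uniformly_continuous_on UNIV f" "\<And>x. x \<in> S \<Longrightarrow> L x = f x"
    using uniformly_continuous_on_extension_on_closure[of S L] S(2) by metis
  have cont: "(\<lambda>n. f (u n)) \<longlonglongrightarrow> f x" if "u \<longlonglongrightarrow> x" for u x
    using uniformly_continuous_imp_continuous[OF f(1)] that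
    by (intro isCont_tendsto_compose[of x f]) (auto simp: continuous_on_eq_continuous_at)
  have approx: "\<exists>u. (\<forall>n. u n \<in> S) \<and> u \<longlonglongrightarrow> x" for x
    using S(2) closure_sequential[of x S] by simp
  have "f (x + y) = f x + f y" for x y
  proof -
    obtain u v where u: "\<And>n. u n \<in> S" "u \<longlonglongrightarrow> x" and v: "\<And>n. v n \<in> S" "v \<longlonglongrightarrow> y"
      using approx by metis
    have "f (u n + v n) = f (u n) + f (v n)" for n
      using L_add[OF u(1) v(1)] f(2) u(1) v(1) X.subspace_add[OF S(1) u(1) v(1)] by simp
    then have "(\<lambda>n. f (u n + v n)) \<longlonglongrightarrow> f x + f y"
      using tendsto_add[OF cont[OF u(2)] cont[OF v(2)]] by simp
    then show ?thesis
      using cont[OF tendsto_add[OF u(2) v(2)]] LIMSEQ_unique by blast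
  qed
  moreover have "f (sX a x) = sG a (f x)" for a x
  proof -
    obtain u where u: "\<And>n. u n \<in> S" "u \<longlonglongrightarrow> x" using approx by metis
    have "f (sX a (u n)) = sG a (f (u n))" for n
      using L_scale[OF u(1)] f(2) u(1) X.subspace_scale[OF S(1) u(1)] by simp
    then have "(\<lambda>n. f (sX a (u n))) \<longlonglongrightarrow> sG a (f x)"
      using bounded_linear.tendsto[OF G.bounded_linear_scale cont[OF u(2)]] by simp
    then show ?thesis
      using cont[OF bounded_linear.tendsto[OF X.bounded_linear_scale u(2)]] LIMSEQ_unique by blast
  qed
  moreover have "norm (f x) = norm x" for x
  proof -
    obtain u where u: "\<And>n. u n \<in> S" "u \<longlonglongrightarrow> x" using approx by metis
    have "norm (f (u n)) = norm (u n)" for n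
      using L_norm[OF u(1)] f(2) u(1) by simp
    then show ?thesis
      using tendsto_norm[OF cont[OF u(2)]] tendsto_norm[OF u(2)] LIMSEQ_unique by auto
  qed
  ultimately show thesis
    by (intro that[of f]) (simp add: isometry_on_def linear_map_on_def)
qed

text \<open>
  At a point \<open>x\<close> of the union the values \<open>F n x\<close> mean something only once \<open>x \<in> E n\<close>. The hypotheses are
  therefore used for all large \<open>n\<close>, which exist because the sequence \<open>E\<close> is increasing.
\<close>

lemma almost_isometries_limit:
  fixes sX :: "'k::{real_normed_field, euclidean_space} \<Rightarrow> 'x::banach \<Rightarrow> 'x"
    and sG :: "'k \<Rightarrow> 'g::banach \<Rightarrow> 'g"
  assumes "banach_space_over sX" and "banach_space_over sG"
    and sub: "\<And>n. module.subspace sX (E n)" and "incseq E"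
    and F: "\<And>n. almost_isometry_on sX sG (E n) norm (\<epsilon> n) (F n)" and \<epsilon>: "\<epsilon> \<longlonglongrightarrow> 0"
    and "summable c" and step: "\<And>n w. w \<in> E n \<Longrightarrow> norm (F (Suc n) w - F n w) \<le> c n * norm w"
  obtains L where "isometry_on sX sG (\<Union>n. E n) norm norm L"
proof -
  interpret X: banach_space_over sX by fact
  interpret G: banach_space_over sG by fact
  define L where "L x = lim (\<lambda>n. F n x)" for x
  have ev: "\<forall>\<^sub>F n in sequentially. x \<in> E n" if "x \<in> (\<Union>n. E n)" for x
    using that \<open>incseq E\<close> unfolding eventually_sequentially incseq_def by blast
  have lim: "(\<lambda>n. F n x) \<longlonglongrightarrow> L x" if "x \<in> (\<Union>n. E n)" for x
  proof -
    have "summable (\<lambda>n. c n * norm x)" using \<open>summable c\<close> by (rule summable_mult2)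
    moreover have "\<forall>\<^sub>F n in sequentially. norm (F (Suc n) x - F n x) \<le> c n * norm x"
      using ev[OF that] by eventually_elim (rule step)
    ultimately have "summable (\<lambda>n. F (Suc n) x - F n x)"
      by (rule summable_comparison_test_ev[rotated])
    then have "convergent (\<lambda>n. \<Sum>i<n. F (Suc i) x - F i x)" by (simp add: summable_iff_convergent)
    then have "convergent (\<lambda>n. F n x - F 0 x)" by (simp only: sum_lessThan_telescope[of "\<lambda>n. F n x"])
    then have "convergent (\<lambda>n. (F n x - F 0 x) + F 0 x)" by (intro convergent_add convergent_const)
    then show ?thesis by (simp add: L_def convergent_LIMSEQ_iff)
  qed
  have "isometry_on sX sG (\<Union>n. E n) norm norm L"
    unfolding isometry_on_def linear_map_on_def
  proof (intro conjI ballI allI)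
    fix x y assume x: "x \<in> (\<Union>n. E n)" and y: "y \<in> (\<Union>n. E n)"
    have "\<forall>\<^sub>F n in sequentially. F n x + F n y = F n (x + y) \<and> x + y \<in> E n"
      using ev[OF x] ev[OF y]
    proof eventually_elim
      case (elim n)
      then show ?case using F[of n] X.subspace_add[OF sub] by (simp add: almost_isometry_on_def linear_map_on_def)
    qed
    then have "\<forall>\<^sub>F n in sequentially. F n x + F n y = F n (x + y)" and "x + y \<in> (\<Union>n. E n)"
      by (auto elim: eventually_mono simp: eventually_sequentially)
    then have "(\<lambda>n. F n (x + y)) \<longlonglongrightarrow> L x + L y"
      using tendsto_add[OF lim[OF x] lim[OF y]] by (rule_tac Lim_transform_eventually)
    then show "L (x + y) = L x + L y" using lim[OF \<open>x + y \<in> _\<close>] LIMSEQ_unique by blast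
  next
    fix a x assume x: "x \<in> (\<Union>n. E n)"
    have "\<forall>\<^sub>F n in sequentially. sG a (F n x) = F n (sX a x)"
      using ev[OF x]
    proof eventually_elim
      case (elim n)
      then show ?case using F[of n] by (simp add: almost_isometry_on_def linear_map_on_def)
    qed
    then have "(\<lambda>n. F n (sX a x)) \<longlonglongrightarrow> sG a (L x)"
      using bounded_linear.tendsto[OF G.bounded_linear_scale lim[OF x]] by (rule_tac Lim_transform_eventually)
    moreover have "sX a x \<in> (\<Union>n. E n)" using x X.subspace_scale[OF sub] by blast
    ultimately show "L (sX a x) = sG a (L x)" using lim LIMSEQ_unique by blast
  next
    fix x assume x: "x \<in> (\<Union>n. E n)"
    have "\<forall>\<^sub>F n in sequentially. norm (norm (F n x) - norm x) \<le> \<epsilon> n * norm x"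
      using ev[OF x]
    proof eventually_elim
      case (elim n)
      then show ?case using F[of n] by (simp add: almost_isometry_on_def)
    qed
    moreover have "(\<lambda>n. \<epsilon> n * norm x) \<longlonglongrightarrow> 0" using \<epsilon> by (rule tendsto_mult_left_zero)
    ultimately have "(\<lambda>n. norm (F n x) - norm x) \<longlonglongrightarrow> 0" by (rule Lim_null_comparison)
    then have "(\<lambda>n. norm (F n x)) \<longlonglongrightarrow> norm x" by (simp add: LIM_zero_iff)
    then show "norm (L x) = norm x" using tendsto_norm[OF lim[OF x]] LIMSEQ_unique by blast
  qed
  then show thesis by (rule that)
qed

section \<open>Universality\<close>

theorem theorem3p2:
  fixes sG :: "'k::{real_normed_field, euclidean_space} \<Rightarrow> 'g::banach \<Rightarrow> 'g"
    and sX :: "'k \<Rightarrow> 'x::banach \<Rightarrow> 'x"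
  assumes "gurarii_space sG"
    and "banach_space_over sX"
    and "separable_space (euclidean :: 'x topology)"
  shows "\<exists>f. isometry_on sX sG UNIV norm norm f"
proof -
  interpret X: banach_space_over sX by fact
  interpret G: banach_space_over sG using assms(1) by (simp add: gurarii_space_def)
  obtain D :: "'x set" where D: "countable D" "closure D = UNIV"
    using assms(3) by (auto simp: separable_space_def)
  then have "D \<noteq> {}" by auto
  define d where "d = from_nat_into D"
  have range_d: "range d = D"
    unfolding d_def by (rule range_from_nat_into) fact+
  define E where "E n = X.span (d ` {..<n})" for n
  have incE: "incseq E"
    unfolding E_def by (intro monoI X.span_mono image_mono) auto
  have subE: "X.subspace (E n)" for n by (simp add: E_def X.subspace_span)
  define \<epsilon> :: "nat \<Rightarrow> real" where "\<epsilon> n = (1 / 2) ^ n" for n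
  have eps: "0 < \<epsilon> n" "\<epsilon> n \<le> 1" for n by (auto simp: \<epsilon>_def power_le_one)
  \<comment> \<open>Since \<open>E 0 = {0}\<close>, the construction can start from the zero map.\<close>
  have "\<exists>F. \<forall>n. almost_isometry_on sX sG (E n) norm (\<epsilon> n) (F n) \<and>
    (\<forall>w\<in>E n. norm (F (Suc n) w - F n w) \<le> 2 * \<epsilon> n * norm w)"
  proof (rule dependent_nat_choice)
    have "almost_isometry_on sX sG (E 0) norm (\<epsilon> 0) (\<lambda>_. 0)"
      by (auto simp: almost_isometry_on_def linear_map_on_def E_def)
    then show "\<exists>f. almost_isometry_on sX sG (E 0) norm (\<epsilon> 0) f" by blast
  next
    fix f n assume "almost_isometry_on sX sG (E n) norm (\<epsilon> n) f"
    then interpret almost_isometry sX sG "E n" "\<epsilon> n" f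
      using subE eps by unfold_locales
    obtain g where g: "almost_isometry_on sX sG (X.span (d ` {..<Suc n})) norm (\<epsilon> (Suc n)) g"
      and gf: "\<And>w. w \<in> E n \<Longrightarrow> norm (g w - f w) \<le> (1 + \<epsilon> (Suc n)) * (\<epsilon> n * norm w)"
      by (rule almost_isometry_improve[OF assms(1), of "\<epsilon> (Suc n)" "d ` {..<n}" "d ` {..<Suc n}"])
        (auto simp: E_def eps)
    have "norm (g w - f w) \<le> 2 * \<epsilon> n * norm w" if "w \<in> E n" for w
    proof -
      have "(1 + \<epsilon> (Suc n)) * (\<epsilon> n * norm w) \<le> 2 * (\<epsilon> n * norm w)"
        using eps[of "Suc n"] eps(1)[of n] by (intro mult_right_mono) auto
      then show ?thesis using gf[OF that] by simp
    qed
    then show "\<exists>g. almost_isometry_on sX sG (E (Suc n)) norm (\<epsilon> (Suc n)) g \<and>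
      (\<forall>w\<in>E n. norm (g w - f w) \<le> 2 * \<epsilon> n * norm w)"
      using g unfolding E_def by blast
  qed
  then obtain F where F: "\<And>n. almost_isometry_on sX sG (E n) norm (\<epsilon> n) (F n)"
    "\<And>n w. w \<in> E n \<Longrightarrow> norm (F (Suc n) w - F n w) \<le> 2 * \<epsilon> n * norm w"
    by blast
  have "\<epsilon> \<longlonglongrightarrow> 0" "summable (\<lambda>n. 2 * \<epsilon> n)"
    unfolding \<epsilon>_def by (auto intro!: LIMSEQ_power_zero summable_mult summable_geometric)
  then obtain L where L: "isometry_on sX sG (\<Union>n. E n) norm norm L"
    using almost_isometries_limit[OF assms(2) G.banach_space_over_axioms subE incE F(1) _ _ F(2)] by blast
  have "X.subspace (\<Union>n. E n)"
    unfolding X.subspace_def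
  proof (intro conjI ballI allI)
    show "0 \<in> (\<Union>n. E n)" using X.subspace_0[OF subE] by blast
    show "sX a x \<in> (\<Union>n. E n)" if "x \<in> (\<Union>n. E n)" for a x
      using that X.subspace_scale[OF subE] by blast
    fix x y assume "x \<in> (\<Union>n. E n)" "y \<in> (\<Union>n. E n)"
    then obtain m n where "x \<in> E m" "y \<in> E n" by blast
    then have "x \<in> E (max m n)" "y \<in> E (max m n)"
      using incseqD[OF incE, of m "max m n"] incseqD[OF incE, of n "max m n"] by auto
    then show "x + y \<in> (\<Union>n. E n)" using X.subspace_add[OF subE] by blast
  qed
  moreover have "D \<subseteq> (\<Union>n. E n)"
    unfolding range_d[symmetric] E_def by (auto intro!: X.span_base)
  then have "closure (\<Union>n. E n) = UNIV" using D(2) closure_mono by blast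
  ultimately show ?thesis
    using isometry_extend_dense[OF assms(2) G.banach_space_over_axioms _ _ L] by blast
qed

end
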